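(* Define the following subsets of $I$: $$\mathsf{A}^{\uparrow}_0=\{t\in I\mid a_j'(t)>0\ \text{ and }\ a_j'(t)b_j(t)=a_j(t)b_j'(t)\ \text{ for all } j=0,1,\ldots,n\},$$ $$\mathsf{A}^{\uparrow}_1=\{t\in I\mid a_0'(t)>0\ \text{ and, for all } j=1,\ldots,n,\ \ a_j'(t)>0\ \text{ and }\ a_{j-1}'(t)b_j(t)=a_{j-1}(t)b_j'(t)\},$$ and let $\mathsf{A}^{\downarrow}_0$ and $\mathsf{A}^{\downarrow}_1$ be defined in the same way with every $>$ replaced by $<$. Then: (1) for every $t\in\mathsf{A}^{\uparrow}_0\cap\mathsf{A}^{\uparrow}_1$, the eigenvalues of $A'(t)$, listed in increasing order $\lambda_0(A',t),\ldots,\lambda_n(A',t)$, satisfy $$0<\lambda_0(A',t)=\lambda_0'(A,t)<\cdots<\lambda_n(A',t)=\lambda_n'(A,t);$$ (2) for every $t\in\mathsf{A}^{\downarrow}_0\cap\mathsf{A}^{\downarrow}_1$, the eigenvalues of $A'(t)$, listed in decreasing order $\lambda_0(A',t),\ldots,\lambda_n(A',t)$, satisfy $$0>\lambda_0(A',t)=\lambda_0'(A,t)>\cdots>\lambda_n(A',t)=\lambda_n'(A,t).$$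
   Context: Let $n$ be a positive integer, $I\subseteq\mathbb{R}$ a non-empty open interval, and let $a_0,\ldots,a_n,b_0,\ldots,b_n:I\to\mathbb{R}$ be continuously differentiable functions with, for all $t\in I$, $a_j(t)>0$ for $j=0,\ldots,n$, $b_j(t)>0$ for $j=1,\ldots,n$, and $b_0(t)\ge 0$. The prime denotes differentiation with respect to $t$. The birth and death matrix $A(t)$ is the $(n+1)\times(n+1)$ tridiagonal matrix (rows and columns indexed by $0,\ldots,n$) with diagonal entries $A(t)_{j,j}=a_j(t)+b_j(t)$ ($0\le j\le n$), superdiagonal entries $A(t)_{j,j+1}=a_j(t)$ and subdiagonal entries $A(t)_{j+1,j}=b_{j+1}(t)$ ($0\le j\le n-1$), and zeros elsewhere. $A'(t)$ is its entrywise derivative. The eigenvalues of $A(t)$ are real and simple, denoted in increasing order by $\lambda_0(A,t)<\cdots<\lambda_n(A,t)$; they are differentiable functions of $t$, and $\lambda_k'(A,t)$ denotes the derivative of $t\mapsto\lambda_k(A,t)$. *)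

theory Defs
  imports "HOL-Analysis.Derivative" "HOL-Library.Multiset" "Jordan_Normal_Form.Char_Poly"
begin

definition birth_death_matrix ::
    "nat \<Rightarrow> (nat \<Rightarrow> real \<Rightarrow> real) \<Rightarrow> (nat \<Rightarrow> real \<Rightarrow> real) \<Rightarrow> real \<Rightarrow> real mat" where
  "birth_death_matrix n a b t = mat (n + 1) (n + 1) (\<lambda>(i, j).
     if i = j then a j t + b j t
     else if j = i + 1 then a i t
     else if i = j + 1 then b i t
     else 0)"

definition mat_deriv :: "(real \<Rightarrow> real mat) \<Rightarrow> real \<Rightarrow> real mat" where
  "mat_deriv F t = mat (dim_row (F t)) (dim_col (F t)) (\<lambda>(i, j). deriv (\<lambda>s. F s $$ (i, j)) t)"

text \<open>
  The real eigenvalues of a square matrix in increasing order, repeated according to algebraic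
  multiplicity. For an \<open>m \<times> m\<close> matrix the list has length \<open>m\<close> iff all complex eigenvalues
  are real. Birth and death matrices have \<open>n + 1\<close> real simple eigenvalues, so all
  \<open>n + 1\<close> positions of their lists are meaningful.
\<close>
definition eigenvalue_list :: "real mat \<Rightarrow> real list" where
  "eigenvalue_list M = sorted_list_of_multiset (proots (char_poly M))"

lemma set_eigenvalue_list:
  assumes "M \<in> carrier_mat m m"
  shows "set (eigenvalue_list M) = {x. eigenvalue M x}"
proof -
  have "char_poly M \<noteq> 0"
    using degree_monic_char_poly[OF assms] by auto
  then show ?thesis
    by (simp add: eigenvalue_list_def eigenvalue_root_char_poly[OF assms])
qed

definition A0_up :: "nat \<Rightarrow> real set \<Rightarrow> (nat \<Rightarrow> real \<Rightarrow> real) \<Rightarrow> (nat \<Rightarrow> real \<Rightarrow> real) \<Rightarrow> real set" where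
  "A0_up n I a b = {t \<in> I. \<forall>j\<in>{0..n}.
     deriv (a j) t > 0 \<and> deriv (a j) t * b j t = a j t * deriv (b j) t}"

definition A1_up :: "nat \<Rightarrow> real set \<Rightarrow> (nat \<Rightarrow> real \<Rightarrow> real) \<Rightarrow> (nat \<Rightarrow> real \<Rightarrow> real) \<Rightarrow> real set" where
  "A1_up n I a b = {t \<in> I. deriv (a 0) t > 0 \<and> (\<forall>j\<in>{1..n}.
     deriv (a j) t > 0 \<and> deriv (a (j - 1)) t * b j t = a (j - 1) t * deriv (b j) t)}"

definition A0_down :: "nat \<Rightarrow> real set \<Rightarrow> (nat \<Rightarrow> real \<Rightarrow> real) \<Rightarrow> (nat \<Rightarrow> real \<Rightarrow> real) \<Rightarrow> real set" where
  "A0_down n I a b = {t \<in> I. \<forall>j\<in>{0..n}.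
     deriv (a j) t < 0 \<and> deriv (a j) t * b j t = a j t * deriv (b j) t}"

definition A1_down :: "nat \<Rightarrow> real set \<Rightarrow> (nat \<Rightarrow> real \<Rightarrow> real) \<Rightarrow> (nat \<Rightarrow> real \<Rightarrow> real) \<Rightarrow> real set" where
  "A1_down n I a b = {t \<in> I. deriv (a 0) t < 0 \<and> (\<forall>j\<in>{1..n}.
     deriv (a j) t < 0 \<and> deriv (a (j - 1)) t * b j t = a (j - 1) t * deriv (b j) t)}"

end

theory Submission
  imports Defs
begin

text \<open>
  The two families of equations in the hypothesis say that \<open>b\<^sub>j'/b\<^sub>j = a\<^sub>j'/a\<^sub>j\<close> and
  \<open>b\<^sub>j'/b\<^sub>j = a\<^sub>j\<^sub>-\<^sub>1'/a\<^sub>j\<^sub>-\<^sub>1\<close>. Together they force all nonzero entries of \<open>A\<close> to have one common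
  logarithmic derivative \<open>c\<close> at \<open>t\<close>, so \<open>A'(t) = c A(t)\<close> and the eigenvalues of \<open>A'(t)\<close> are the
  numbers \<open>c \<lambda>\<^sub>k\<close>, where \<open>\<lambda>\<^sub>0 < \<dots> < \<lambda>\<^sub>n\<close> are the eigenvalues of \<open>A(t)\<close>. Since the \<open>\<lambda>\<^sub>k\<close> are positive,
  the sign of \<open>c\<close> decides between the two halves of the theorem. Two things need an
  argument: \<open>A(t)\<close> has \<open>n + 1\<close> distinct positive eigenvalues, and \<open>\<lambda>\<^sub>k\<close> has derivative \<open>c \<lambda>\<^sub>k\<close>.

  For the first, the eigenvector equation of a birth and death matrix can be solved from the top
  row downwards, starting with \<open>v\<^sub>0 = 1\<close>. This gives polynomials \<open>v\<^sub>j\<close> of degree \<open>j\<close> in the eigenvalue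
  parameter, and every root of \<open>v\<^sub>n\<^sub>+\<^sub>1\<close> is an eigenvalue. The three-term recursion makes the roots of
  consecutive \<open>v\<^sub>j\<close> interlace, which produces \<open>n + 1\<close> distinct roots of \<open>v\<^sub>n\<^sub>+\<^sub>1\<close>
  (lemma \<open>bd_poly_roots\<close>); since the alternating sign pattern of the \<open>v\<^sub>j\<close> already holds at \<open>0\<close>, all of
  these roots are positive.

  For the second, let the parameter \<open>x\<close> move along a line \<open>x(s) = \<lambda>\<^sub>k + (c \<lambda>\<^sub>k + e)(s - t)\<close>. To first
  order \<open>A(s)\<close> is \<open>(1 + c(s - t)) A(t)\<close>, and \<open>v\<^sub>j\<close> does not change when \<open>x\<close> and all rates are
  multiplied by the same factor; hence the derivative of \<open>v\<^sub>n\<^sub>+\<^sub>1\<close> along the line is \<open>e\<close> times its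
  derivative in \<open>x\<close> (lemma \<open>bd_poly_derivative_along_line\<close>). The latter is nonzero by a Wronskian
  identity (lemma \<open>bd_poly_wronskian\<close>), so for \<open>e = \<plusminus>\<epsilon>\<close> the values have opposite signs and a root of
  \<open>v\<^sub>n\<^sub>+\<^sub>1\<close>, that is an eigenvalue of \<open>A(s)\<close>, is caught between the two lines
  (lemma \<open>zero_between_lines\<close>). The \<open>n + 1\<close> eigenvalues found in this way are in increasing order for
  \<open>s\<close> near \<open>t\<close>, so they are the whole list (lemma \<open>eigenvalue_list_has_derivative\<close>).
\<close>

section \<open>Lists of eigenvalues\<close>

text \<open>
  An \<open>m \<times> m\<close> matrix has at most \<open>m\<close> eigenvalues with multiplicity, so \<open>m\<close> distinct ones leave
  no room for others or for multiplicities.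
\<close>

lemma eigenvalue_list_eqI:
  assumes M: "M \<in> carrier_mat m m"
    and mono: "strict_mono_on {..<m} r"
    and ev: "\<And>k. k < m \<Longrightarrow> eigenvalue M (r k)"
  shows "eigenvalue_list M = map r [0..<m]"
proof -
  have deg: "degree (char_poly M) = m" and nz: "char_poly M \<noteq> 0"
    using degree_monic_char_poly[OF M] by auto
  have inj: "inj_on r {..<m}"
    using mono by (rule strict_mono_on_imp_inj_on)
  have "mset_set (r ` {..<m}) \<subseteq># proots (char_poly M)"
  proof (rule mset_subset_eqI)
    fix x
    show "count (mset_set (r ` {..<m})) x \<le> count (proots (char_poly M)) x"
      using ev nz
      by (auto simp: count_mset_set' eigenvalue_root_char_poly[OF M] Suc_le_eq order_root)
  qed
  moreover have "size (proots (char_poly M)) \<le> size (mset_set (r ` {..<m}))"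
    using size_proots_le[of "char_poly M"] by (simp add: deg card_image[OF inj])
  ultimately have "proots (char_poly M) = mset_set (r ` {..<m})"
    by (metis mset_subset_size subset_mset.le_neq_trans not_le)
  also have "\<dots> = mset (map r [0..<m])"
    using inj by (simp add: image_mset_mset_set[symmetric] atLeast0LessThan)
  finally have "eigenvalue_list M = sort (map r [0..<m])"
    by (simp only: eigenvalue_list_def sorted_list_of_multiset_mset)
  also have "\<dots> = map r [0..<m]"
    using mono by (intro sorted_sort_id)
      (auto simp: sorted_iff_nth_mono le_less strict_mono_on_def)
  finally show ?thesis .
qed

lemma eigenvalue_smult_mat:
  fixes M :: "real mat"
  assumes M: "M \<in> carrier_mat m m" and x: "eigenvalue M x"
  shows "eigenvalue (c \<cdot>\<^sub>m M) (c * x)"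
proof -
  obtain w where w: "w \<in> carrier_vec m" "w \<noteq> 0\<^sub>v m" "M *\<^sub>v w = x \<cdot>\<^sub>v w"
    using M x by (auto simp: eigenvalue_def eigenvector_def)
  have "(c \<cdot>\<^sub>m M) *\<^sub>v w = c \<cdot>\<^sub>v (M *\<^sub>v w)"
    using M w(1) by (intro eq_vecI) auto
  then show ?thesis
    using M w unfolding eigenvalue_def eigenvector_def
    by (intro exI[of _ w]) (auto simp: smult_smult_assoc)
qed

text \<open>
  Simple real eigenvalues can be differentiated one at a time: it is enough that, for every
  \<open>\<epsilon>\<close>, the matrix \<open>F s\<close> has an eigenvalue within \<open>\<epsilon> \<bar>s - t\<bar>\<close> of each line
  \<open>l k + d k * (s - t)\<close>. Near \<open>t\<close> these approximations keep the order of the \<open>l k\<close>,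
  which identifies them with the sorted eigenvalues.
\<close>

lemma eigenvalue_list_has_derivative:
  fixes F :: "real \<Rightarrow> real mat"
  assumes F: "\<And>s. F s \<in> carrier_mat m m"
    and mono: "strict_mono_on {..<m} l"
    and ev: "\<And>k. k < m \<Longrightarrow> eigenvalue (F t) (l k)"
    and near: "\<And>k \<epsilon>. k < m \<Longrightarrow> \<epsilon> > 0 \<Longrightarrow>
      \<forall>\<^sub>F s in at t. \<exists>x. eigenvalue (F s) x \<and> \<bar>x - (l k + d k * (s - t))\<bar> \<le> \<epsilon> * \<bar>s - t\<bar>"
    and k: "k < m"
  shows "((\<lambda>s. eigenvalue_list (F s) ! k) has_real_derivative d k) (at t)"
proof -
  have "((\<lambda>s. (eigenvalue_list (F s) ! k - eigenvalue_list (F t) ! k) / (s - t)) \<longlongrightarrow> d k) (at t)"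
  proof (rule tendstoI)
    fix e :: real
    assume "e > 0"
    define \<epsilon> where "\<epsilon> = e / 2"
    have \<epsilon>: "\<epsilon> > 0" "\<epsilon> < e"
      using \<open>e > 0\<close> by (auto simp: \<epsilon>_def)
    let ?near = "\<lambda>s i x. eigenvalue (F s) x \<and> \<bar>x - (l i + d i * (s - t))\<bar> \<le> \<epsilon> * \<bar>s - t\<bar>"
    have approx: "\<forall>\<^sub>F s in at t. \<forall>i\<in>{..<m}. \<exists>x. ?near s i x"
      by (intro eventually_ball_finite ballI near \<epsilon>) auto
    have "\<forall>\<^sub>F s in at t. l i + d i * (s - t) + \<epsilon> * \<bar>s - t\<bar> < l j + d j * (s - t) - \<epsilon> * \<bar>s - t\<bar>"
      if "i < j" "j < m" for i j
    proof -
      have "((\<lambda>s. (l j + d j * (s - t) - \<epsilon> * \<bar>s - t\<bar>) - (l i + d i * (s - t) + \<epsilon> * \<bar>s - t\<bar>))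
          \<longlongrightarrow> (l j + d j * (t - t) - \<epsilon> * \<bar>t - t\<bar>) - (l i + d i * (t - t) + \<epsilon> * \<bar>t - t\<bar>)) (at t)"
        by (intro tendsto_intros)
      moreover have "0 < (l j + d j * (t - t) - \<epsilon> * \<bar>t - t\<bar>) - (l i + d i * (t - t) + \<epsilon> * \<bar>t - t\<bar>)"
        using mono that by (auto simp: strict_mono_on_def)
      ultimately have "\<forall>\<^sub>F s in at t.
          0 < (l j + d j * (s - t) - \<epsilon> * \<bar>s - t\<bar>) - (l i + d i * (s - t) + \<epsilon> * \<bar>s - t\<bar>)"
        by (rule order_tendstoD(1))
      then show ?thesis
        by eventually_elim linarith
    qed
    then have ordered: "\<forall>\<^sub>F s in at t. \<forall>j\<in>{..<m}. \<forall>i\<in>{..<j}.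
        l i + d i * (s - t) + \<epsilon> * \<bar>s - t\<bar> < l j + d j * (s - t) - \<epsilon> * \<bar>s - t\<bar>"
      by (intro eventually_ball_finite ballI) auto
    have at_t: "eigenvalue_list (F t) = map l [0..<m]"
      using F mono ev by (rule eigenvalue_list_eqI)
    show "\<forall>\<^sub>F s in at t.
        dist ((eigenvalue_list (F s) ! k - eigenvalue_list (F t) ! k) / (s - t)) (d k) < e"
      using approx ordered eventually_neq_at_within[of t t UNIV]
    proof eventually_elim
      case (elim s)
      from elim(1) obtain r where r: "\<And>i. i < m \<Longrightarrow> ?near s i (r i)"
        by (metis lessThan_iff)
      have "strict_mono_on {..<m} r"
      proof (rule strict_mono_onI)
        fix i j
        assume ij: "i \<in> {..<m}" "j \<in> {..<m}" "i < j"
        have "r i \<le> l i + d i * (s - t) + \<epsilon> * \<bar>s - t\<bar>"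
          using r[of i] ij by (simp add: abs_le_iff)
        also have "\<dots> < l j + d j * (s - t) - \<epsilon> * \<bar>s - t\<bar>"
          using elim(2) ij by blast
        also have "\<dots> \<le> r j"
          using r[of j] ij by (simp add: abs_le_iff)
        finally show "r i < r j" .
      qed
      then have "eigenvalue_list (F s) = map r [0..<m]"
        using F r by (intro eigenvalue_list_eqI) auto
      then have "(eigenvalue_list (F s) ! k - eigenvalue_list (F t) ! k) / (s - t) - d k
          = (r k - (l k + d k * (s - t))) / (s - t)"
        using k elim(3) by (simp add: at_t field_simps)
      also have "\<bar>\<dots>\<bar> \<le> \<epsilon>"
        using r[OF k] elim(3) by (simp add: abs_divide pos_divide_le_eq)
      finally show ?case
        using \<epsilon> by (simp add: dist_real_def)
    qed
  qed
  then show ?thesis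
    by (simp add: has_field_derivative_iff)
qed

section \<open>Zeros caught between two lines\<close>

text \<open>
  If the derivative of \<open>f\<close> along the line of slope \<open>d + e\<close> is \<open>e * D\<close>, then
  \<open>f\<close> has opposite signs on the lines of slope \<open>d + \<epsilon>\<close> and \<open>d - \<epsilon>\<close>, on both sides of \<open>t\<close>. This is
  the implicit function theorem at a single point, without assuming that \<open>f\<close> is differentiable as
  a function of two variables.
\<close>

lemma zero_between_lines:
  fixes f :: "real \<Rightarrow> real \<Rightarrow> real"
  assumes zero: "f t l = 0"
    and der: "\<And>e. ((\<lambda>s. f s (l + (d + e) * (s - t))) has_real_derivative e * D) (at t)"
    and D: "D \<noteq> 0"
    and cont: "\<And>s. continuous_on UNIV (f s)"
    and \<epsilon>: "\<epsilon> > 0"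
  shows "\<forall>\<^sub>F s in at t. \<exists>x. f s x = 0 \<and> \<bar>x - (l + d * (s - t))\<bar> \<le> \<epsilon> * \<bar>s - t\<bar>"
proof -
  define g where "g e s = f s (l + (d + e) * (s - t))" for e s
  have quot: "((\<lambda>s. g e s / (s - t)) \<longlongrightarrow> e * D) (at t)" for e
    using der[of e] zero by (simp add: g_def has_field_derivative_iff)
  have "((\<lambda>s. (g \<epsilon> s / (s - t)) * (g (- \<epsilon>) s / (s - t))) \<longlongrightarrow> (\<epsilon> * D) * (- \<epsilon> * D)) (at t)"
    by (intro tendsto_mult quot)
  moreover have "(\<epsilon> * D) * (- \<epsilon> * D) < 0"
    using \<epsilon> D by (simp add: mult_less_0_iff zero_less_mult_iff) (meson linorder_neqE_linordered_idom)
  ultimately have "\<forall>\<^sub>F s in at t. (g \<epsilon> s / (s - t)) * (g (- \<epsilon>) s / (s - t)) < 0"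
    by (rule order_tendstoD(2))
  then show ?thesis
    using eventually_neq_at_within[of t t UNIV]
  proof eventually_elim
    case (elim s)
    have "g \<epsilon> s * g (- \<epsilon>) s < 0"
      using elim by (simp add: divide_less_0_iff not_less power2_eq_square[symmetric])
    define u v where "u = l + d * (s - t) - \<epsilon> * \<bar>s - t\<bar>" and "v = l + d * (s - t) + \<epsilon> * \<bar>s - t\<bar>"
    have "f s u * f s v < 0"
    proof (cases "s > t")
      case True
      then have "u = l + (d - \<epsilon>) * (s - t)" "v = l + (d + \<epsilon>) * (s - t)"
        by (auto simp: u_def v_def algebra_simps)
      then show ?thesis
        using \<open>g \<epsilon> s * g (- \<epsilon>) s < 0\<close> by (simp add: g_def mult.commute)
    next
      case False
      then have "v = l + (d - \<epsilon>) * (s - t)" "u = l + (d + \<epsilon>) * (s - t)"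
        by (auto simp: u_def v_def algebra_simps)
      then show ?thesis
        using \<open>g \<epsilon> s * g (- \<epsilon>) s < 0\<close> by (simp add: g_def mult.commute)
    qed
    moreover have "u \<le> v"
      using \<epsilon> by (simp add: u_def v_def)
    moreover have "continuous_on {u..v} (f s)"
      using cont continuous_on_subset by blast
    ultimately have "\<exists>x\<ge>u. x \<le> v \<and> f s x = 0"
      by (cases "f s u < 0") (auto simp: mult_less_0_iff intro: IVT' IVT2')
    then show ?case
      by (auto simp: u_def v_def abs_le_iff algebra_simps)
  qed
qed

section \<open>The eigenvector polynomials of a birth and death matrix\<close>

text \<open>
  Component \<open>j\<close> of the solution of \<open>A v = x v\<close> with \<open>v\<^sub>0 = 1\<close>, as a polynomial in \<open>x\<close>: row \<open>j\<close> of the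
  matrix reads \<open>b\<^sub>j v\<^sub>j\<^sub>-\<^sub>1 + (a\<^sub>j + b\<^sub>j) v\<^sub>j + a\<^sub>j v\<^sub>j\<^sub>+\<^sub>1 = x v\<^sub>j\<close> and is solved for \<open>v\<^sub>j\<^sub>+\<^sub>1\<close>. In the last
  row of an \<open>(n + 1) \<times> (n + 1)\<close> matrix the term \<open>a\<^sub>n v\<^sub>n\<^sub>+\<^sub>1\<close> is absent, so \<open>v\<^sub>n\<^sub>+\<^sub>1\<close> measures the
  failure of \<open>v\<close> to be an eigenvector.
\<close>

fun bd_poly :: "(nat \<Rightarrow> real) \<Rightarrow> (nat \<Rightarrow> real) \<Rightarrow> nat \<Rightarrow> real poly" where
  "bd_poly a b 0 = 1"
| "bd_poly a b (Suc 0) = [:- (1 + b 0 / a 0), 1 / a 0:]"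
| "bd_poly a b (Suc (Suc j)) =
    [:- (1 + b (Suc j) / a (Suc j)), 1 / a (Suc j):] * bd_poly a b (Suc j)
    - Polynomial.smult (b (Suc j) / a (Suc j)) (bd_poly a b j)"

lemma poly_bd_poly_rec:
  "poly (bd_poly a b (Suc (Suc j))) x =
    (x / a (Suc j) - 1 - b (Suc j) / a (Suc j)) * poly (bd_poly a b (Suc j)) x
    - b (Suc j) / a (Suc j) * poly (bd_poly a b j) x"
  by (simp add: algebra_simps)

lemma poly_pderiv_bd_poly_rec:
  "poly (pderiv (bd_poly a b (Suc (Suc j)))) x =
    1 / a (Suc j) * poly (bd_poly a b (Suc j)) x
    + (x / a (Suc j) - 1 - b (Suc j) / a (Suc j)) * poly (pderiv (bd_poly a b (Suc j))) x
    - b (Suc j) / a (Suc j) * poly (pderiv (bd_poly a b j)) x"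
  unfolding bd_poly.simps pderiv_diff pderiv_smult pderiv_mult
  by (simp add: pderiv_pCons algebra_simps)

lemma eigenvalue_birth_death_matrix:
  assumes a: "\<And>j. j \<le> n \<Longrightarrow> a j s \<noteq> 0"
    and root: "poly (bd_poly (\<lambda>j. a j s) (\<lambda>j. b j s) (Suc n)) x = 0"
  shows "eigenvalue (birth_death_matrix n a b s) x"
proof -
  define p where "p j = poly (bd_poly (\<lambda>j. a j s) (\<lambda>j. b j s) j) x" for j
  define w where "w = vec (n + 1) p"
  have p0: "p 0 = 1"
    by (simp add: p_def)
  have pn: "p (Suc n) = 0"
    using root by (simp add: p_def)
  have first: "(a 0 s + b 0 s) * p 0 + a 0 s * p (Suc 0) = x * p 0"
    using a[of 0] by (simp add: p_def field_simps)
  have rest: "b (Suc j) s * p j + (a (Suc j) s + b (Suc j) s) * p (Suc j)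
      + a (Suc j) s * p (Suc (Suc j)) = x * p (Suc j)" if "Suc j \<le> n" for j
    using a[OF that] unfolding p_def poly_bd_poly_rec by (simp add: field_simps)
  have "birth_death_matrix n a b s *\<^sub>v w = x \<cdot>\<^sub>v w"
  proof (rule eq_vecI)
    fix i
    assume "i < dim_vec (x \<cdot>\<^sub>v w)"
    then have i: "i \<le> n"
      by (simp add: w_def)
    have "(birth_death_matrix n a b s *\<^sub>v w) $ i =
        (\<Sum>j = 0..<n + 1. (if i = j then a j s + b j s else if j = i + 1 then a i s
          else if i = j + 1 then b i s else 0) * p j)"
      using i by (simp add: birth_death_matrix_def w_def scalar_prod_def del: upt_Suc sum.op_ivl_Suc)
    also have "\<dots> = (\<Sum>j = 0..<n + 1. (if i = j then (a i s + b i s) * p i else 0)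
        + (if Suc i = j then a i s * p (Suc i) else 0)
        + (if i = Suc j then b i s * p (i - 1) else 0))"
      by (intro sum.cong) auto
    also have "\<dots> = (a i s + b i s) * p i + a i s * p (Suc i)
        + (if i = 0 then 0 else b i s * p (i - 1))"
    proof -
      have "(\<Sum>j = 0..<n + 1. (if i = Suc j then b i s * p (i - 1) else 0))
          = (if i = 0 then 0 else b i s * p (i - 1))"
        using i by (cases i) (simp_all del: sum.op_ivl_Suc)
      moreover have "Suc i = Suc n" if "\<not> Suc i < n + 1"
        using that i by simp
      ultimately show ?thesis
        using i pn by (auto simp: sum.distrib simp del: sum.op_ivl_Suc)
    qed
    also have "\<dots> = x * p i"
      using first rest[of "i - 1"] i by (cases i) (auto simp: algebra_simps)
    finally show "(birth_death_matrix n a b s *\<^sub>v w) $ i = (x \<cdot>\<^sub>v w) $ i"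
      using i by (simp add: w_def)
  qed (simp add: w_def birth_death_matrix_def)
  moreover have "w \<noteq> 0\<^sub>v (n + 1)"
  proof
    assume "w = 0\<^sub>v (n + 1)"
    then have "w $ 0 = 0"
      by simp
    then show False
      by (simp add: w_def p0)
  qed
  ultimately show ?thesis
    unfolding eigenvalue_def eigenvector_def
    by (intro exI[of _ w]) (auto simp: w_def birth_death_matrix_def)
qed

text \<open>
  Multiplying \<open>x\<close> and all rates by the same factor leaves \<open>bd_poly\<close> unchanged. This is why only the
  deviation \<open>e\<close> of the slope of the line from \<open>c * l\<close> contributes.
\<close>

lemma bd_poly_derivative_along_line:
  fixes a b :: "nat \<Rightarrow> real \<Rightarrow> real"
  assumes a: "\<And>j. j < m \<Longrightarrow> a j t \<noteq> 0"
    and a': "\<And>j. j < m \<Longrightarrow> (a j has_real_derivative c * a j t) (at t)"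
    and b': "\<And>j. j < m \<Longrightarrow> (b j has_real_derivative c * b j t) (at t)"
  shows "((\<lambda>s. poly (bd_poly (\<lambda>j. a j s) (\<lambda>j. b j s) m) (l + (c * l + e) * (s - t)))
    has_real_derivative e * poly (pderiv (bd_poly (\<lambda>j. a j t) (\<lambda>j. b j t) m)) l) (at t)"
  using assms
proof (induction m rule: less_induct)
  case (less m)
  have factor: "((\<lambda>s. (l + (c * l + e) * (s - t)) / a j s - 1 - b j s / a j s)
      has_real_derivative e / a j t) (at t)"
    and ratio: "((\<lambda>s. b j s / a j s) has_real_derivative 0) (at t)"
    if "j < m" for j
    using less.prems(1)[OF that]
    by (auto intro!: derivative_eq_intros less.prems(2,3)[OF that] simp: field_simps)
  consider "m = 0" | "m = Suc 0" | j where "m = Suc (Suc j)"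
    by (metis not0_implies_Suc)
  then show ?case
  proof cases
    case 1
    then show ?thesis by simp
  next
    case 2
    have "poly (bd_poly (\<lambda>j. a j s) (\<lambda>j. b j s) (Suc 0)) x = x / a 0 s - 1 - b 0 s / a 0 s" for s x
      by simp
    then show ?thesis
      using factor[of 0] 2 by (simp add: pderiv_pCons del: bd_poly.simps(2)) (simp add: pderiv_pCons)
  next
    case (3 j)
    let ?p = "\<lambda>i s. bd_poly (\<lambda>j. a j s) (\<lambda>j. b j s) i"
    let ?x = "\<lambda>s. l + (c * l + e) * (s - t)"
    have IH: "((\<lambda>s. poly (?p i s) (?x s)) has_real_derivative
        e * poly (pderiv (?p i t)) l) (at t)" if "i < m" for i
      using less.IH[OF that] less.prems that by auto
    have "Suc j < m" "j < m"
      using 3 by auto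
    show ?thesis
      unfolding 3 poly_bd_poly_rec poly_pderiv_bd_poly_rec
      by (rule DERIV_cong[OF DERIV_diff[OF DERIV_mult[OF factor[OF \<open>Suc j < m\<close>] IH[OF \<open>Suc j < m\<close>]]
            DERIV_mult[OF ratio[OF \<open>Suc j < m\<close>] IH[OF \<open>j < m\<close>]]]])
        (simp add: algebra_simps)
  qed
qed

section \<open>Roots of the eigenvector polynomials\<close>

text \<open>
  At an increasing sequence of points where a continuous function alternates in sign, ending with a
  positive value, there is a zero in every gap.
\<close>

lemma zeros_between_alternating_signs:
  fixes f :: "real \<Rightarrow> real"
  assumes cont: "continuous_on UNIV f"
    and g: "\<And>i. i < m \<Longrightarrow> g i < g (Suc i)"
    and alt: "\<And>i. i \<le> m \<Longrightarrow> 0 < (-1) ^ (m - i) * f (g i)"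
  shows "\<exists>r. \<forall>i<m. g i < r i \<and> r i < g (Suc i) \<and> f (r i) = 0"
proof -
  have "\<exists>x. g i < x \<and> x < g (Suc i) \<and> f x = 0" if i: "i < m" for i
  proof -
    let ?h = "\<lambda>x. (-1) ^ (m - Suc i) * f x"
    have "m - i = Suc (m - Suc i)"
      using i by simp
    then have neg: "?h (g i) < 0" and pos: "0 < ?h (g (Suc i))"
      using alt[of i] alt[of "Suc i"] i by auto
    have "continuous_on {g i..g (Suc i)} ?h"
      using cont by (intro continuous_intros) (auto intro: continuous_on_subset)
    then obtain x where x: "g i \<le> x" "x \<le> g (Suc i)" "?h x = 0"
      using IVT'[of ?h "g i" 0 "g (Suc i)"] neg pos g[OF i] by auto
    moreover have "x \<noteq> g i" "x \<noteq> g (Suc i)"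
      using x neg pos by auto
    ultimately show ?thesis
      by (intro exI[of _ x]) auto
  qed
  then show ?thesis
    by metis
qed

text \<open>
  A polynomial of degree \<open>m\<close> with \<open>m\<close> roots splits into linear factors; to the right of exactly
  \<open>k\<close> of the roots, the remaining \<open>m - k\<close> factors are negative.
\<close>

lemma sign_between_roots:
  fixes p :: "real poly"
  assumes deg: "degree p \<le> m" and lead: "0 < poly.coeff p m"
    and inj: "inj_on r {..<m}"
    and root: "\<And>i. i < m \<Longrightarrow> poly p (r i) = 0"
    and left: "\<And>i. i < k \<Longrightarrow> r i < x"
    and right: "\<And>i. k \<le> i \<Longrightarrow> i < m \<Longrightarrow> x < r i"
    and "k \<le> m"
  shows "0 < (-1) ^ (m - k) * poly p x"
proof -
  let ?q = "\<Prod>i<m. [:- r i, 1:]"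
  have degq: "degree ?q = m"
    by (simp add: degree_prod_sum_eq)
  have "poly.coeff ?q m = 1"
    using monic_prod[of "{..<m}" "\<lambda>i. [:- r i, 1:]"] by (simp add: degq)
  then have "p = Polynomial.smult (poly.coeff p m) ?q"
    using deg root degq
    by (intro poly_eqI_degree_lead_coeff[where A = "r ` {..<m}" and n = m])
      (auto simp: card_image[OF inj] poly_prod intro: degree_smult_le[THEN order_trans])
  then have "poly p x = poly.coeff p m * (\<Prod>i<m. x - r i)"
    by (metis (no_types, lifting) poly_smult poly_prod prod.cong poly_pCons poly_0 mult_1_right
        add.commute mult_zero_right add.right_neutral uminus_add_conv_diff)
  also have "(\<Prod>i<m. x - r i) = (\<Prod>i<k. x - r i) * (\<Prod>i=k..<m. x - r i)"
    using \<open>k \<le> m\<close> by (simp add: lessThan_atLeast0 prod.atLeastLessThan_concat)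
  also have "(\<Prod>i=k..<m. x - r i) = (-1) ^ (m - k) * (\<Prod>i=k..<m. r i - x)"
    using prod.distrib[of "\<lambda>_. - 1" "\<lambda>i. r i - x" "{k..<m}"] by simp
  finally have "(-1) ^ (m - k) * poly p x
      = poly.coeff p m * (\<Prod>i<k. x - r i) * (\<Prod>i=k..<m. r i - x)"
    by (simp add: algebra_simps flip: power_add)
  also have "\<dots> > 0"
    using lead left right by (intro mult_pos_pos prod_pos) auto
  finally show ?thesis .
qed

locale birth_death_rates =
  fixes n :: nat and a b :: "nat \<Rightarrow> real"
  assumes a_pos: "j \<le> n \<Longrightarrow> 0 < a j"
    and b_pos: "1 \<le> j \<Longrightarrow> j \<le> n \<Longrightarrow> 0 < b j"
    and b_0: "0 \<le> b 0"
begin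

abbreviation v :: "nat \<Rightarrow> real poly" where
  "v \<equiv> bd_poly a b"

lemma b_nonneg: "j \<le> n \<Longrightarrow> 0 \<le> b j"
  using b_0 b_pos[of j] by (cases j) auto

lemma degree_bd_poly: "degree (v j) \<le> j"
proof (induction j rule: less_induct)
  case (less j)
  consider "j = 0" | "j = Suc 0" | i where "j = Suc (Suc i)"
    by (metis not0_implies_Suc)
  then show ?case
  proof cases
    case (3 i)
    have "degree ([:- (1 + b (Suc i) / a (Suc i)), 1 / a (Suc i):] * v (Suc i)) \<le> 1 + Suc i"
      using less.IH[of "Suc i"] 3 by (intro order_trans[OF degree_mult_le] add_mono) auto
    moreover have "degree (Polynomial.smult (b (Suc i) / a (Suc i)) (v i)) \<le> 1 + Suc i"
      using less.IH[of i] 3 by (intro order_trans[OF degree_smult_le]) auto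
    ultimately show ?thesis
      unfolding 3 bd_poly.simps by (intro degree_diff_le) auto
  qed auto
qed

lemma lead_coeff_bd_poly: "j \<le> Suc n \<Longrightarrow> 0 < poly.coeff (v j) j"
proof (induction j rule: less_induct)
  case (less j)
  consider "j = 0" | "j = Suc 0" | i where "j = Suc (Suc i)"
    by (metis not0_implies_Suc)
  then show ?case
  proof cases
    case 2
    then show ?thesis
      using a_pos[of 0] by simp
  next
    case (3 i)
    have "poly.coeff (v (Suc i)) (Suc (Suc i)) = 0" "poly.coeff (v i) (Suc (Suc i)) = 0"
      using degree_bd_poly[of "Suc i"] degree_bd_poly[of i] by (auto intro!: coeff_eq_0)
    then have "poly.coeff (v j) j = 1 / a (Suc i) * poly.coeff (v (Suc i)) (Suc i)"
      by (simp add: 3)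
    also have "\<dots> > 0"
      using less.IH[of "Suc i"] less.prems a_pos[of "Suc i"] 3 by simp
    finally show ?thesis .
  qed auto
qed

text \<open>
  At \<open>0\<close> the recursion reads
  \<open>w\<^sub>j\<^sub>+\<^sub>1 - w\<^sub>j = (b\<^sub>j/a\<^sub>j) (w\<^sub>j - w\<^sub>j\<^sub>-\<^sub>1)\<close> for \<open>w\<^sub>j = (-1)\<^sup>j v\<^sub>j(0)\<close>, so the
  increments remain nonnegative, starting from \<open>w\<^sub>1 - w\<^sub>0 = b\<^sub>0/a\<^sub>0\<close>.
\<close>

lemma bd_poly_alternating_at_0:
  assumes "j \<le> n"
  shows "0 < (-1) ^ j * poly (v j) 0 \<and> (-1) ^ j * poly (v j) 0 \<le> (-1) ^ Suc j * poly (v (Suc j)) 0"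
  using assms
proof (induction j)
  case 0
  then show ?case
    using a_pos[of 0] b_0 by simp
next
  case (Suc j)
  define w where "w i = (-1) ^ i * poly (v i) 0" for i
  have IH: "0 < w j" "w j \<le> w (Suc j)"
    using Suc by (auto simp: w_def)
  define g where "g = b (Suc j) / a (Suc j)"
  have g: "0 \<le> g"
    using a_pos[of "Suc j"] b_pos[of "Suc j"] Suc.prems by (simp add: g_def)
  have "w (Suc (Suc j)) = w (Suc j) + g * (w (Suc j) - w j)"
    unfolding w_def poly_bd_poly_rec by (simp add: g_def algebra_simps)
  moreover have "0 \<le> g * (w (Suc j) - w j)"
    using g IH by simp
  ultimately have "w (Suc j) \<le> w (Suc (Suc j))"
    by linarith
  then show ?case
    using IH by (simp add: w_def)
qed

text \<open>
  The bound on \<open>X\<close> makes the factor \<open>X/a\<^sub>j - 1 - b\<^sub>j/a\<^sub>j\<close> of \<open>v\<^sub>j\<close> at least \<open>1 + b\<^sub>j/a\<^sub>j\<close>, the absolute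
  value of the same factor at \<open>0\<close>; so the values at \<open>X\<close> cannot decrease with \<open>j\<close>, for the reason
  that applies to \<open>\<bar>v\<^sub>j(0)\<bar>\<close>.
\<close>

lemma bd_poly_positive_far_right:
  assumes X: "\<And>j. j \<le> n \<Longrightarrow> 2 * (a j + b j) \<le> X" and "j \<le> n"
  shows "0 < poly (v j) X \<and> poly (v j) X \<le> poly (v (Suc j)) X"
  using \<open>j \<le> n\<close>
proof (induction j)
  case 0
  then show ?case
    using a_pos[of 0] b_0 X[of 0] by (simp add: field_simps)
next
  case (Suc j)
  have IH: "0 < poly (v j) X" "poly (v j) X \<le> poly (v (Suc j)) X"
    using Suc by auto
  define g where "g = b (Suc j) / a (Suc j)"
  have g: "0 \<le> g"
    using a_pos[of "Suc j"] b_pos[of "Suc j"] Suc.prems by (simp add: g_def)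
  have "1 + g \<le> X / a (Suc j) - 1 - g"
    using divide_right_mono[OF X[of "Suc j"], of "a (Suc j)"] a_pos[of "Suc j"] Suc.prems
    by (simp add: g_def add_divide_distrib)
  then have "(1 + g) * poly (v (Suc j)) X \<le> (X / a (Suc j) - 1 - g) * poly (v (Suc j)) X"
    using IH by (intro mult_right_mono) auto
  then have "poly (v (Suc j)) X + g * (poly (v (Suc j)) X - poly (v j) X) \<le> poly (v (Suc (Suc j))) X"
    unfolding poly_bd_poly_rec by (simp add: g_def algebra_simps)
  moreover have "0 \<le> g * (poly (v (Suc j)) X - poly (v j) X)"
    using g IH by simp
  ultimately show ?case
    using IH by linarith
qed

text \<open>
  The three-term recursion turns the Wronskian \<open>W\<^sub>j\<close> of two consecutive polynomials into
  \<open>W\<^sub>j = v\<^sub>j\<^sup>2/a\<^sub>j + (b\<^sub>j/a\<^sub>j) W\<^sub>j\<^sub>-\<^sub>1\<close>. Positivity shows in particular that all real roots are simple.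
\<close>

lemma bd_poly_wronskian:
  assumes "j \<le> n"
  shows "0 < poly (pderiv (v (Suc j))) x * poly (v j) x - poly (pderiv (v j)) x * poly (v (Suc j)) x"
  using assms
proof (induction j)
  case 0
  then show ?case
    using a_pos[of 0] by (simp add: pderiv_pCons)
next
  case (Suc j)
  let ?W = "\<lambda>j. poly (pderiv (v (Suc j))) x * poly (v j) x - poly (pderiv (v j)) x * poly (v (Suc j)) x"
  have "?W (Suc j) = 1 / a (Suc j) * (poly (v (Suc j)) x)\<^sup>2 + b (Suc j) / a (Suc j) * ?W j"
    unfolding poly_bd_poly_rec poly_pderiv_bd_poly_rec by (simp add: algebra_simps power2_eq_square)
  also have "\<dots> > 0"
    using Suc a_pos[of "Suc j"] b_pos[of "Suc j"]
    by (intro add_nonneg_pos mult_nonneg_nonneg mult_pos_pos divide_pos_pos) auto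
  finally show ?case .
qed

text \<open>
  The induction carries the sign of \<open>v\<^sub>m\<^sub>-\<^sub>1\<close> at the roots of \<open>v\<^sub>m\<close>: by the recursion, \<open>v\<^sub>m\<^sub>+\<^sub>1\<close> has
  the opposite sign there. So \<open>v\<^sub>m\<^sub>+\<^sub>1\<close> alternates along the points \<open>0\<close>, the roots of \<open>v\<^sub>m\<close> and \<open>X\<close>,
  and it has one root in each of the \<open>m + 1\<close> gaps.
\<close>

lemma bd_poly_roots_interlace:
  assumes X: "\<And>j. j \<le> n \<Longrightarrow> 2 * (a j + b j) \<le> X" and "m \<le> Suc n"
  shows "\<exists>r. strict_mono_on {..<m} r \<and> (\<forall>i<m. 0 < r i \<and> r i < X \<and> poly (v m) (r i) = 0 \<and>
    (-1) ^ (m - i) * poly (v (m - 1)) (r i) < 0)"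
  using \<open>m \<le> Suc n\<close>
proof (induction m)
  case 0
  then show ?case
    by (simp add: strict_mono_on_def)
next
  case (Suc m)
  then obtain r where mono: "strict_mono_on {..<m} r"
    and r: "\<And>i. i < m \<Longrightarrow> 0 < r i" "\<And>i. i < m \<Longrightarrow> r i < X"
      "\<And>i. i < m \<Longrightarrow> poly (v m) (r i) = 0"
    and sgn: "\<And>i. i < m \<Longrightarrow> (-1) ^ (m - i) * poly (v (m - 1)) (r i) < 0"
    by auto
  have less: "r i < r j" if "i < j" "j < m" for i j
    using mono that by (auto simp: strict_mono_on_def)
  have "0 < X"
    using X[of 0] a_pos[of 0] b_0 by simp
  \<comment> \<open>The points \<open>0\<close>, \<open>r 0\<close>, \<dots>, \<open>r (m - 1)\<close>, \<open>X\<close>.\<close>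
  define g where "g i = (if i = 0 then 0 else if i \<le> m then r (i - 1) else X)" for i
  have g_less: "g i < g j" if "i < j" "j \<le> Suc m" for i j
    using that r \<open>0 < X\<close> less by (auto simp: g_def)
  have alt: "0 < (-1) ^ (Suc m - i) * poly (v (Suc m)) (g i)" if i: "i \<le> Suc m" for i
  proof -
    consider "i = 0" | "i = Suc m" | "1 \<le> i" "i \<le> m"
      using i by linarith
    then show ?thesis
    proof cases
      case 1
      then show ?thesis
        using bd_poly_alternating_at_0[of m] Suc.prems by (simp add: g_def)
    next
      case 2
      then show ?thesis
        using bd_poly_positive_far_right[OF X, of m] Suc.prems by (simp add: g_def)
    next
      case 3
      then obtain m' where m: "m = Suc m'"
        by (metis not0_implies_Suc not_one_le_zero le_zero_eq)
      let ?x = "r (i - 1)"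
      have "(-1) ^ (Suc m - i) * poly (v m') ?x < 0"
        using sgn[of "i - 1"] 3 by (simp add: m Suc_diff_le)
      moreover have "poly (v (Suc m)) ?x = - (b m / a m) * poly (v m') ?x"
        using r(3)[of "i - 1"] 3 unfolding m poly_bd_poly_rec by simp
      moreover have "0 < b m / a m"
        using a_pos[of m] b_pos[of m] Suc.prems m by simp
      ultimately have "0 < (b m / a m) * - ((-1) ^ (Suc m - i) * poly (v m') ?x)"
        by (intro mult_pos_pos) auto
      also have "\<dots> = (-1) ^ (Suc m - i) * poly (v (Suc m)) ?x"
        using \<open>poly (v (Suc m)) ?x = _\<close> by simp
      finally show ?thesis
        using 3 by (simp add: g_def)
    qed
  qed
  have "\<exists>s. \<forall>i<Suc m. g i < s i \<and> s i < g (Suc i) \<and> poly (v (Suc m)) (s i) = 0"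
    by (intro zeros_between_alternating_signs continuous_intros g_less alt) auto
  then obtain s where s: "\<And>i. i < Suc m \<Longrightarrow> g i < s i" "\<And>i. i < Suc m \<Longrightarrow> s i < g (Suc i)"
      "\<And>i. i < Suc m \<Longrightarrow> poly (v (Suc m)) (s i) = 0"
    by blast
  have g_le: "g i \<le> g j" if "i \<le> j" "j \<le> Suc m" for i j
    using g_less[of i j] that by (cases "i = j") auto
  have "strict_mono_on {..<Suc m} s"
  proof (rule strict_mono_onI)
    fix i j
    assume "i \<in> {..<Suc m}" "j \<in> {..<Suc m}" "i < j"
    then show "s i < s j"
      using s(2)[of i] g_le[of "Suc i" j] s(1)[of j] by simp
  qed
  moreover have "0 < s i" "s i < X" if "i < Suc m" for i
    using s(1,2)[OF that] g_le[of 0 i] g_le[of "Suc i" "Suc m"] that by (auto simp: g_def)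
  moreover have "(-1) ^ (Suc m - i) * poly (v m) (s i) < 0" if i: "i < Suc m" for i
  proof -
    have "0 < (-1) ^ (m - i) * poly (v m) (s i)"
    proof (rule sign_between_roots[OF degree_bd_poly lead_coeff_bd_poly])
      show "inj_on r {..<m}"
        using mono by (rule strict_mono_on_imp_inj_on)
      show "r l < s i" if "l < i" for l
        using g_le[of "Suc l" i] s(1)[of i] that i by (simp add: g_def)
      show "s i < r l" if "i \<le> l" "l < m" for l
        using g_le[of "Suc i" "Suc l"] s(2)[of i] that i by (simp add: g_def)
    qed (use r Suc.prems i in auto)
    then show ?thesis
      using i by (simp add: Suc_diff_le)
  qed
  ultimately show ?case
    using s(3) by (intro exI[of _ s]) auto
qed

lemma bd_poly_roots:
  obtains r where "strict_mono_on {..<Suc n} r"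
    and "\<And>k. k \<le> n \<Longrightarrow> 0 < r k"
    and "\<And>k. k \<le> n \<Longrightarrow> poly (v (Suc n)) (r k) = 0"
    and "\<And>k. k \<le> n \<Longrightarrow> poly (pderiv (v (Suc n))) (r k) \<noteq> 0"
proof -
  define X where "X = (\<Sum>j\<le>n. 2 * (a j + b j))"
  have "2 * (a j + b j) \<le> X" if "j \<le> n" for j
    unfolding X_def using that a_pos b_nonneg
    by (intro member_le_sum) (auto simp: add_nonneg_nonneg less_imp_le)
  then obtain r where r: "strict_mono_on {..<Suc n} r"
      "\<And>k. k < Suc n \<Longrightarrow> 0 < r k \<and> poly (v (Suc n)) (r k) = 0"
    using bd_poly_roots_interlace[of X "Suc n"] by auto
  have "poly (pderiv (v (Suc n))) (r k) \<noteq> 0" if "k \<le> n" for k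
    using bd_poly_wronskian[of n "r k"] r(2)[of k] that by auto
  with r show ?thesis
    by (intro that[of r]) auto
qed

end

section \<open>Rates with a common logarithmic derivative\<close>

lemma birth_death_matrix_carrier: "birth_death_matrix n a b s \<in> carrier_mat (n + 1) (n + 1)"
  by (simp add: birth_death_matrix_def)

text \<open>
  The eigenvalues of \<open>A(s)\<close> near \<open>l k\<close> are found as roots of the polynomial \<open>v\<^sub>n\<^sub>+\<^sub>1\<close> of the rates at time
  \<open>s\<close>; that its derivative at the simple root \<open>l k\<close> does not vanish gives them the slope \<open>c * l k\<close>.
\<close>

lemma birth_death_eigenvalues_derivative:
  fixes a b :: "nat \<Rightarrow> real \<Rightarrow> real"
  assumes I: "open I" "t \<in> I"
    and rates: "\<And>s. s \<in> I \<Longrightarrow> birth_death_rates n (\<lambda>j. a j s) (\<lambda>j. b j s)"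
    and a': "\<And>j. j \<le> n \<Longrightarrow> (a j has_real_derivative c * a j t) (at t)"
    and b': "\<And>j. j \<le> n \<Longrightarrow> (b j has_real_derivative c * b j t) (at t)"
  obtains l where "strict_mono_on {..<n + 1} l"
    and "\<And>k. k \<le> n \<Longrightarrow> 0 < l k"
    and "\<And>k. k \<le> n \<Longrightarrow> eigenvalue (birth_death_matrix n a b t) (l k)"
    and "\<And>k. k \<le> n \<Longrightarrow>
      ((\<lambda>s. eigenvalue_list (birth_death_matrix n a b s) ! k) has_real_derivative c * l k) (at t)"
proof -
  define p where "p s = bd_poly (\<lambda>j. a j s) (\<lambda>j. b j s) (Suc n)" for s
  have a_nz: "a j s \<noteq> 0" if "j \<le> n" "s \<in> I" for j s
    using birth_death_rates.a_pos[OF rates] that by fastforce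
  have ev: "eigenvalue (birth_death_matrix n a b s) x" if "poly (p s) x = 0" "s \<in> I" for s x
    using that a_nz unfolding p_def by (intro eigenvalue_birth_death_matrix) auto
  obtain l where l: "strict_mono_on {..<Suc n} l" "\<And>k. k \<le> n \<Longrightarrow> 0 < l k"
      "\<And>k. k \<le> n \<Longrightarrow> poly (p t) (l k) = 0" "\<And>k. k \<le> n \<Longrightarrow> poly (pderiv (p t)) (l k) \<noteq> 0"
    unfolding p_def using birth_death_rates.bd_poly_roots[OF rates[OF I(2)]] by metis
  have "((\<lambda>s. eigenvalue_list (birth_death_matrix n a b s) ! k) has_real_derivative c * l k) (at t)"
    if "k \<le> n" for k
  proof (rule eigenvalue_list_has_derivative[where F = "birth_death_matrix n a b"
        and d = "\<lambda>k. c * l k", OF birth_death_matrix_carrier])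
    show "\<forall>\<^sub>F s in at t. \<exists>x. eigenvalue (birth_death_matrix n a b s) x \<and>
        \<bar>x - (l k + c * l k * (s - t))\<bar> \<le> \<epsilon> * \<bar>s - t\<bar>"
      if "k < n + 1" "0 < \<epsilon>" for k \<epsilon>
    proof -
      have "((\<lambda>s. poly (p s) (l k + (c * l k + e) * (s - t)))
          has_real_derivative e * poly (pderiv (p t)) (l k)) (at t)" for e
        unfolding p_def using a_nz I a' b' by (intro bd_poly_derivative_along_line) auto
      then have "\<forall>\<^sub>F s in at t. \<exists>x. poly (p s) x = 0 \<and>
          \<bar>x - (l k + c * l k * (s - t))\<bar> \<le> \<epsilon> * \<bar>s - t\<bar>"
        using l that by (intro zero_between_lines) (auto intro: continuous_intros)
      moreover have "\<forall>\<^sub>F s in at t. s \<in> I"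
        using I by (rule eventually_at_in_open')
      ultimately show ?thesis
        by eventually_elim (use ev in blast)
    qed
  qed (use l ev I that in auto)
  with l ev I show ?thesis
    by (intro that[of l]) auto
qed

lemma mat_deriv_birth_death_matrix:
  fixes a b :: "nat \<Rightarrow> real \<Rightarrow> real"
  assumes a': "\<And>j. j \<le> n \<Longrightarrow> (a j has_real_derivative c * a j t) (at t)"
    and b': "\<And>j. j \<le> n \<Longrightarrow> (b j has_real_derivative c * b j t) (at t)"
  shows "mat_deriv (birth_death_matrix n a b) t = c \<cdot>\<^sub>m birth_death_matrix n a b t"
proof (rule eq_matI)
  fix i j
  assume "i < dim_row (c \<cdot>\<^sub>m birth_death_matrix n a b t)"
    "j < dim_col (c \<cdot>\<^sub>m birth_death_matrix n a b t)"
  then have ij: "i \<le> n" "j \<le> n"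
    by (auto simp: birth_death_matrix_def)
  have "((\<lambda>s. birth_death_matrix n a b s $$ (i, j)) has_real_derivative
      c * birth_death_matrix n a b t $$ (i, j)) (at t)"
    using ij DERIV_add[OF a'[of j] b'[of j]] a' b'
    by (auto simp: birth_death_matrix_def distrib_left)
  then have "deriv (\<lambda>s. birth_death_matrix n a b s $$ (i, j)) t
      = c * birth_death_matrix n a b t $$ (i, j)"
    by (rule DERIV_imp_deriv)
  then show "mat_deriv (birth_death_matrix n a b) t $$ (i, j)
      = (c \<cdot>\<^sub>m birth_death_matrix n a b t) $$ (i, j)"
    using ij by (simp add: mat_deriv_def birth_death_matrix_carrier[THEN carrier_matD(1)]
        birth_death_matrix_carrier[THEN carrier_matD(2)])
qed (auto simp: mat_deriv_def)

text \<open>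
  The first family of equations identifies the logarithmic derivatives of \<open>a\<^sub>j\<close> and \<open>b\<^sub>j\<close>, the
  second one those of \<open>a\<^sub>j\<^sub>-\<^sub>1\<close> and \<open>b\<^sub>j\<close>; together they link \<open>a\<^sub>j\<^sub>-\<^sub>1\<close> to \<open>a\<^sub>j\<close>. For
  \<open>j = 0\<close> the rate \<open>b\<^sub>0\<close> may vanish, and then the first equation says that \<open>b\<^sub>0' = 0\<close>.
\<close>

lemma common_logarithmic_derivative:
  fixes a b a' b' :: "nat \<Rightarrow> real"
  assumes rates: "birth_death_rates n a b"
    and same: "\<And>j. j \<le> n \<Longrightarrow> a' j * b j = a j * b' j"
    and shifted: "\<And>j. 1 \<le> j \<Longrightarrow> j \<le> n \<Longrightarrow> a' (j - 1) * b j = a (j - 1) * b' j"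
    and "j \<le> n"
  shows "a' j = a' 0 / a 0 * a j \<and> b' j = a' 0 / a 0 * b j"
proof -
  interpret birth_death_rates n a b
    by (rule rates)
  have a: "a' j = a' 0 / a 0 * a j" if "j \<le> n" for j
    using that
  proof (induction j)
    case 0
    then show ?case
      using a_pos[of 0] by simp
  next
    case (Suc j)
    have pos: "0 < a j" "0 < a (Suc j)" "0 < b (Suc j)"
      using a_pos b_pos Suc.prems by auto
    have "a' j / a j = b' (Suc j) / b (Suc j)"
      using shifted[of "Suc j"] Suc.prems pos by (simp add: field_simps)
    also have "\<dots> = a' (Suc j) / a (Suc j)"
      using same[of "Suc j"] Suc.prems pos by (simp add: field_simps)
    finally have "a' (Suc j) / a (Suc j) = a' 0 / a 0"
      using Suc pos by simp
    then show ?case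
      using pos by (simp add: divide_eq_eq)
  qed
  have "a j * b' j = a j * (a' 0 / a 0 * b j)"
    using same[OF \<open>j \<le> n\<close>] a[OF \<open>j \<le> n\<close>] by (metis mult.assoc mult.commute)
  then have "b' j = a' 0 / a 0 * b j"
    using a_pos[OF \<open>j \<le> n\<close>] by (simp only: mult_cancel_left) auto
  with a[OF \<open>j \<le> n\<close>] show ?thesis
    by blast
qed

theorem theorem4p1:
  fixes n :: nat and I :: "real set" and a b :: "nat \<Rightarrow> real \<Rightarrow> real"
  assumes "n > 0"
    and "open I" and "is_interval I" and "I \<noteq> {}"
    and "\<And>j. j \<le> n \<Longrightarrow> (a j) C1_differentiable_on I"
    and "\<And>j. j \<le> n \<Longrightarrow> (b j) C1_differentiable_on I"
    and "\<And>j t. j \<le> n \<Longrightarrow> t \<in> I \<Longrightarrow> a j t > 0"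
    and "\<And>j t. 1 \<le> j \<Longrightarrow> j \<le> n \<Longrightarrow> t \<in> I \<Longrightarrow> b j t > 0"
    and "\<And>t. t \<in> I \<Longrightarrow> b 0 t \<ge> 0"
  shows "(\<forall>t \<in> A0_up n I a b \<inter> A1_up n I a b.
            let \<mu> = eigenvalue_list (mat_deriv (birth_death_matrix n a b) t) in
            length \<mu> = n + 1 \<and> 0 < \<mu> ! 0 \<and> (\<forall>k<n. \<mu> ! k < \<mu> ! (k + 1)) \<and>
            (\<forall>k\<le>n. ((\<lambda>s. eigenvalue_list (birth_death_matrix n a b s) ! k)
                       has_real_derivative \<mu> ! k) (at t)))
       \<and> (\<forall>t \<in> A0_down n I a b \<inter> A1_down n I a b.
            let \<mu> = rev (eigenvalue_list (mat_deriv (birth_death_matrix n a b) t)) in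
            length \<mu> = n + 1 \<and> 0 > \<mu> ! 0 \<and> (\<forall>k<n. \<mu> ! k > \<mu> ! (k + 1)) \<and>
            (\<forall>k\<le>n. ((\<lambda>s. eigenvalue_list (birth_death_matrix n a b s) ! k)
                       has_real_derivative \<mu> ! k) (at t)))"
proof -
  have rates: "birth_death_rates n (\<lambda>j. a j s) (\<lambda>j. b j s)" if "s \<in> I" for s
    using assms(7-9) that by unfold_locales auto
  have deriv: "(f has_real_derivative deriv f t) (at t)"
    if "f C1_differentiable_on I" "t \<in> I" for f :: "real \<Rightarrow> real" and t
    using that by (simp add: C1_differentiable_on_eq DERIV_deriv_iff_real_differentiable)
  have key: "\<exists>c l. deriv (a 0) t = c * a 0 t \<and> strict_mono_on {..<n + 1} l \<and> (\<forall>k\<le>n. 0 < l k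
        \<and> eigenvalue (mat_deriv (birth_death_matrix n a b) t) (c * l k)
        \<and> ((\<lambda>s. eigenvalue_list (birth_death_matrix n a b s) ! k)
            has_real_derivative c * l k) (at t))"
    if t: "t \<in> I"
      and same: "\<And>j. j \<le> n \<Longrightarrow> deriv (a j) t * b j t = a j t * deriv (b j) t"
      and shifted: "\<And>j. 1 \<le> j \<Longrightarrow> j \<le> n \<Longrightarrow>
        deriv (a (j - 1)) t * b j t = a (j - 1) t * deriv (b j) t" for t
  proof -
    define c where "c = deriv (a 0) t / a 0 t"
    have c: "deriv (a j) t = c * a j t" "deriv (b j) t = c * b j t" if "j \<le> n" for j
      using common_logarithmic_derivative[where a' = "\<lambda>j. deriv (a j) t" and b' = "\<lambda>j. deriv (b j) t",
          OF rates[OF t] same shifted that]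
      by (auto simp: c_def)
    have a': "(a j has_real_derivative c * a j t) (at t)"
      and b': "(b j has_real_derivative c * b j t) (at t)" if "j \<le> n" for j
      using deriv[OF assms(5)[OF that] t] deriv[OF assms(6)[OF that] t] c[OF that] by auto
    obtain l where l: "strict_mono_on {..<n + 1} l" "\<And>k. k \<le> n \<Longrightarrow> 0 < l k"
      "\<And>k. k \<le> n \<Longrightarrow> eigenvalue (birth_death_matrix n a b t) (l k)"
      "\<And>k. k \<le> n \<Longrightarrow> ((\<lambda>s. eigenvalue_list (birth_death_matrix n a b s) ! k)
        has_real_derivative c * l k) (at t)"
      using birth_death_eigenvalues_derivative[OF \<open>open I\<close> t rates a' b'] by metis
    have "mat_deriv (birth_death_matrix n a b) t = c \<cdot>\<^sub>m birth_death_matrix n a b t"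
      using a' b' by (rule mat_deriv_birth_death_matrix)
    then have "eigenvalue (mat_deriv (birth_death_matrix n a b) t) (c * l k)" if "k \<le> n" for k
      using eigenvalue_smult_mat[OF birth_death_matrix_carrier l(3)[OF that]] by simp
    then show ?thesis
      using l c(1)[of 0] by blast
  qed
  have carrier: "mat_deriv (birth_death_matrix n a b) t \<in> carrier_mat (n + 1) (n + 1)" for t
    by (simp add: mat_deriv_def birth_death_matrix_def)
  show ?thesis
  proof (intro conjI ballI)
    fix t
    assume t: "t \<in> A0_up n I a b \<inter> A1_up n I a b"
    then obtain c l where c: "deriv (a 0) t = c * a 0 t"
      and l: "strict_mono_on {..<n + 1} l" and pos: "\<And>k. k \<le> n \<Longrightarrow> 0 < l k"
      and ev: "\<And>k. k \<le> n \<Longrightarrow> eigenvalue (mat_deriv (birth_death_matrix n a b) t) (c * l k)"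
      and der: "\<And>k. k \<le> n \<Longrightarrow> ((\<lambda>s. eigenvalue_list (birth_death_matrix n a b s) ! k)
        has_real_derivative c * l k) (at t)"
      using key[of t] by (auto simp: A0_up_def A1_up_def)
    have "0 < c"
      using t assms(7)[of 0 t] c by (auto simp: A1_up_def zero_less_mult_iff)
    have less: "l i < l j" if "i < j" "j \<le> n" for i j
      using l that by (auto simp: strict_mono_on_def)
    let ?\<mu> = "eigenvalue_list (mat_deriv (birth_death_matrix n a b) t)"
    have "strict_mono_on {..<n + 1} (\<lambda>k. c * l k)"
      using \<open>0 < c\<close> by (intro strict_mono_onI mult_strict_left_mono less) auto
    then have "?\<mu> = map (\<lambda>k. c * l k) [0..<n + 1]"
      using ev by (intro eigenvalue_list_eqI[OF carrier]) auto
    then have len: "length ?\<mu> = n + 1" and nth: "\<And>k. k \<le> n \<Longrightarrow> ?\<mu> ! k = c * l k"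
      by (auto simp: nth_map_upt simp del: upt_Suc)
    have "0 < ?\<mu> ! 0"
      using nth[of 0] mult_pos_pos[OF \<open>0 < c\<close> pos[of 0]] by simp
    moreover have "?\<mu> ! k < ?\<mu> ! (k + 1)" if "k < n" for k
      using nth[of k] nth[of "k + 1"] less[of k "k + 1"] \<open>0 < c\<close> that by simp
    ultimately show "let \<mu> = eigenvalue_list (mat_deriv (birth_death_matrix n a b) t) in
            length \<mu> = n + 1 \<and> 0 < \<mu> ! 0 \<and> (\<forall>k<n. \<mu> ! k < \<mu> ! (k + 1)) \<and>
            (\<forall>k\<le>n. ((\<lambda>s. eigenvalue_list (birth_death_matrix n a b s) ! k)
                       has_real_derivative \<mu> ! k) (at t))"
      using len der nth by (simp add: Let_def)
  next
    fix t
    assume t: "t \<in> A0_down n I a b \<inter> A1_down n I a b"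
    then obtain c l where c: "deriv (a 0) t = c * a 0 t"
      and l: "strict_mono_on {..<n + 1} l" and pos: "\<And>k. k \<le> n \<Longrightarrow> 0 < l k"
      and ev: "\<And>k. k \<le> n \<Longrightarrow> eigenvalue (mat_deriv (birth_death_matrix n a b) t) (c * l k)"
      and der: "\<And>k. k \<le> n \<Longrightarrow> ((\<lambda>s. eigenvalue_list (birth_death_matrix n a b s) ! k)
        has_real_derivative c * l k) (at t)"
      using key[of t] by (auto simp: A0_down_def A1_down_def)
    have "c < 0"
      using t assms(7)[of 0 t] c by (auto simp: A1_down_def mult_less_0_iff)
    have less: "l i < l j" if "i < j" "j \<le> n" for i j
      using l that by (auto simp: strict_mono_on_def)
    let ?\<mu> = "rev (eigenvalue_list (mat_deriv (birth_death_matrix n a b) t))"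
    \<comment> \<open>Multiplication by a negative \<open>c\<close> reverses the order, so the increasing list is read backwards.\<close>
    have "strict_mono_on {..<n + 1} (\<lambda>k. c * l (n - k))"
      using \<open>c < 0\<close> by (intro strict_mono_onI mult_strict_left_mono_neg less) auto
    then have "eigenvalue_list (mat_deriv (birth_death_matrix n a b) t)
        = map (\<lambda>k. c * l (n - k)) [0..<n + 1]"
      using ev by (intro eigenvalue_list_eqI[OF carrier]) auto
    then have "?\<mu> = map (\<lambda>k. c * l k) [0..<n + 1]"
      by (intro nth_equalityI) (auto simp: rev_nth simp del: upt_Suc)
    then have len: "length ?\<mu> = n + 1" and nth: "\<And>k. k \<le> n \<Longrightarrow> ?\<mu> ! k = c * l k"
      by (auto simp: nth_map_upt simp del: upt_Suc)
    have "?\<mu> ! 0 < 0"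
      using nth[of 0] mult_neg_pos[OF \<open>c < 0\<close> pos[of 0]] by simp
    moreover have "?\<mu> ! (k + 1) < ?\<mu> ! k" if "k < n" for k
      using nth[of k] nth[of "k + 1"] less[of k "k + 1"] \<open>c < 0\<close> that
      by (simp add: mult_less_cancel_left)
    ultimately show "let \<mu> = rev (eigenvalue_list (mat_deriv (birth_death_matrix n a b) t)) in
            length \<mu> = n + 1 \<and> 0 > \<mu> ! 0 \<and> (\<forall>k<n. \<mu> ! k > \<mu> ! (k + 1)) \<and>
            (\<forall>k\<le>n. ((\<lambda>s. eigenvalue_list (birth_death_matrix n a b s) ! k)
                       has_real_derivative \<mu> ! k) (at t))"
      using len der nth by (simp add: Let_def)
  qed
qed

end
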